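(* The BCS Hamiltonian $H$ is a bounded, selfadjoint operator on $\mathcal{H}=\mathbb{C}^{2^{2M}}$.
   Context: Fix (large) real numbers $L,K_{max}>0$ and let $\Lambda=\{\frac{2\pi}{L}(n_1,n_2,n_3)\in\mathbb{R}^3: n_1,n_2,n_3\in\mathbb{Z},\ \frac{2\pi}{L}\sqrt{n_1^2+n_2^2+n_3^2}\le K_{max}\}$, a finite set with $M$ elements, whose elements are arranged in a fixed order. Let $\mathcal{H}=\mathbb{C}^{2^{2M}}$ with its standard inner product $(\cdot,\cdot)$; its standard unit vectors are labelled $|n_{k\uparrow},n_{k\downarrow},n_{k'\uparrow},n_{k'\downarrow},\ldots\rangle$ with $n_{k\sigma}\in\{0,1\}$, $k\in\Lambda$, $\sigma\in\{\uparrow,\downarrow\}$. The annihilation operator $C_{k\sigma}$ is the linear operator on $\mathcal{H}$ which sends a standard unit vector with $n_{k\sigma}=1$ to $(-1)^{s}$ times the standard unit vector obtained by replacing $n_{k\sigma}$ by $0$, where $s$ is the sum of the occupation numbers to the left of $n_{k\sigma}$, and sends a standard unit vector with $n_{k\sigma}=0$ to $0$. The creation operator $C_{k\sigma}^*$ sends a standard unit vector with $n_{k\sigma}=0$ to $(-1)^{s}$ times the one with $n_{k\sigma}$ replaced by $1$ (same $s$), and one with $n_{k\sigma}=1$ to $0$. Let $m,\mu,\hbar>0$ and $\xi_k=\hbar^2|k|^2/(2m)-\mu$. Let $U_{k,k'}$ ($k,k'\in\Lambda$) be real with $U_{k,k'}\le 0$, $U_{k',k}=U_{k,k'}$, $U_{-k,-k'}=U_{k,k'}$,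 $U_{k,k}=0$. The BCS Hamiltonian is $$H=\sum_{k\in\Lambda,\,\sigma=\uparrow,\downarrow}\xi_kC_{k\sigma}^*C_{k\sigma}+\sum_{k,k'\in\Lambda}U_{k,k'}C_{k'\uparrow}^*C_{-k'\downarrow}^*C_{-k\downarrow}C_{k\uparrow}.$$ *)

theory Defs
  imports "HOL-Analysis.Analysis"
begin

definition Lam :: "real \<Rightarrow> real \<Rightarrow> (real^3) set" where
  "Lam L Kmax = {(2 * pi / L) *\<^sub>R vector [of_int n1, of_int n2, of_int n3] | n1 n2 n3 :: int.
     2 * pi / L * sqrt (of_int (n1\<^sup>2 + n2\<^sup>2 + n3\<^sup>2)) \<le> Kmax}"

datatype spin = Up | Down

type_synonym mode = "(real^3) \<times> spin"

definition modes :: "(real^3) set \<Rightarrow> mode set" where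
  "modes \<Lambda> = \<Lambda> \<times> {Up, Down}"

definition occupations :: "(real^3) set \<Rightarrow> (mode \<Rightarrow> nat) set" where
  "occupations \<Lambda> = modes \<Lambda> \<rightarrow>\<^sub>E {0, 1}"

text \<open>
  The Hilbert space is \<^typ>\<open>complex^'n\<close> with coordinates labelled by \<open>occ\<close>, a bijection from \<open>'n\<close> onto
  \<^term>\<open>occupations \<Lambda>\<close>. The fixed order of \<open>\<Lambda>\<close> is given by \<open>pos\<close>, the position of a
  wave vector; within one wave vector the up mode stands to the left of the down mode.
  These definitions are meaningful only for modes in \<^term>\<open>modes \<Lambda>\<close>.
\<close>

definition left_modes :: "(real^3) set \<Rightarrow> (real^3 \<Rightarrow> nat) \<Rightarrow> mode \<Rightarrow> mode set" where
  "left_modes \<Lambda> pos p = {q \<in> modes \<Lambda>. pos (fst q) < pos (fst p)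
     \<or> (fst q = fst p \<and> snd q = Up \<and> snd p = Down)}"

definition ket :: "('n::finite \<Rightarrow> mode \<Rightarrow> nat) \<Rightarrow> (mode \<Rightarrow> nat) \<Rightarrow> complex^'n" where
  "ket occ n = axis (inv occ n) 1"

definition annihilation ::
  "(real^3) set \<Rightarrow> (real^3 \<Rightarrow> nat) \<Rightarrow> ('n::finite \<Rightarrow> mode \<Rightarrow> nat) \<Rightarrow> mode \<Rightarrow> complex^'n \<Rightarrow> complex^'n" where
  "annihilation \<Lambda> pos occ p \<psi> = (\<Sum>j\<in>UNIV. \<psi> $ j *s
     (if occ j p = 1
      then (-1) ^ (\<Sum>q\<in>left_modes \<Lambda> pos p. occ j q) *s ket occ ((occ j)(p := 0))
      else 0))"

definition creation ::
  "(real^3) set \<Rightarrow> (real^3 \<Rightarrow> nat) \<Rightarrow> ('n::finite \<Rightarrow> mode \<Rightarrow> nat) \<Rightarrow> mode \<Rightarrow> complex^'n \<Rightarrow> complex^'n" where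
  "creation \<Lambda> pos occ p \<psi> = (\<Sum>j\<in>UNIV. \<psi> $ j *s
     (if occ j p = 0
      then (-1) ^ (\<Sum>q\<in>left_modes \<Lambda> pos p. occ j q) *s ket occ ((occ j)(p := 1))
      else 0))"

definition xi :: "real \<Rightarrow> real \<Rightarrow> real \<Rightarrow> real^3 \<Rightarrow> real" where
  "xi hbar m \<mu> k = hbar\<^sup>2 * (norm k)\<^sup>2 / (2 * m) - \<mu>"

definition BCS_Hamiltonian ::
  "(real^3) set \<Rightarrow> (real^3 \<Rightarrow> nat) \<Rightarrow> ('n::finite \<Rightarrow> mode \<Rightarrow> nat) \<Rightarrow> (real^3 \<Rightarrow> real)
   \<Rightarrow> (real^3 \<Rightarrow> real^3 \<Rightarrow> real) \<Rightarrow> complex^'n \<Rightarrow> complex^'n" where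
  "BCS_Hamiltonian \<Lambda> pos occ \<xi> U \<psi> =
    (let C = (\<lambda>k \<sigma>. annihilation \<Lambda> pos occ (k, \<sigma>));
         Cs = (\<lambda>k \<sigma>. creation \<Lambda> pos occ (k, \<sigma>))
     in (\<Sum>k\<in>\<Lambda>. \<Sum>\<sigma>\<in>{Up, Down}. complex_of_real (\<xi> k) *s Cs k \<sigma> (C k \<sigma> \<psi>))
      + (\<Sum>k\<in>\<Lambda>. \<Sum>k'\<in>\<Lambda>. complex_of_real (U k k') *s
           Cs k' Up (Cs (- k') Down (C (- k) Down (C k Up \<psi>)))))"

definition cinner :: "complex^'n::finite \<Rightarrow> complex^'n \<Rightarrow> complex" where
  "cinner \<phi> \<psi> = (\<Sum>j\<in>UNIV. \<phi> $ j * cnj (\<psi> $ j))"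

text \<open>\<^const>\<open>bounded_linear\<close> only asserts linearity over the reals, and the norm of
  \<^typ>\<open>complex^'n\<close> is the one induced by \<^const>\<open>cinner\<close>.\<close>

definition bounded_operator :: "(complex^'n::finite \<Rightarrow> complex^'n) \<Rightarrow> bool" where
  "bounded_operator T \<longleftrightarrow> bounded_linear T \<and> (\<forall>c \<psi>. T (c *s \<psi>) = c *s T \<psi>)"

definition is_adjoint ::
  "(complex^'n::finite \<Rightarrow> complex^'n) \<Rightarrow> (complex^'n \<Rightarrow> complex^'n) \<Rightarrow> bool" where
  "is_adjoint T S \<longleftrightarrow> (\<forall>\<phi> \<psi>. cinner (T \<phi>) \<psi> = cinner \<phi> (S \<psi>))"

definition selfadjoint :: "(complex^'n::finite \<Rightarrow> complex^'n) \<Rightarrow> bool" where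
  "selfadjoint T \<longleftrightarrow> is_adjoint T T"

end

(*
  Creation and annihilation of a mode are mutually adjoint: they move the same pairs of basis vectors
  in opposite directions, with the same sign, since the sign only depends on the modes to
  the left. Taking the adjoint of H therefore reverses each product of operators, which fixes every
  kinetic term and exchanges the interaction terms (k,k') and (k',k); U is real and symmetric. Linearity
  need not be checked separately: any map on a finite-dimensional space that has an adjoint is linear,
  hence bounded.
*)
theory Submission
  imports Defs
begin

lemma cinner_add_left: "cinner (\<phi> + \<phi>') \<psi> = cinner \<phi> \<psi> + cinner \<phi>' \<psi>"
  by (simp add: cinner_def sum.distrib distrib_right)

lemma cinner_add_right: "cinner \<phi> (\<psi> + \<psi>') = cinner \<phi> \<psi> + cinner \<phi> \<psi>'"
  by (simp add: cinner_def sum.distrib distrib_left)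

lemma cinner_scale_left: "cinner (c *s \<phi>) \<psi> = c * cinner \<phi> \<psi>"
  by (simp add: cinner_def sum_distrib_left mult.assoc)

lemma cinner_scale_right: "cinner \<phi> (c *s \<psi>) = cnj c * cinner \<phi> \<psi>"
  by (simp add: cinner_def sum_distrib_left mult_ac)

lemma cinner_zero_left [simp]: "cinner 0 \<psi> = 0"
  by (simp add: cinner_def)

lemma cinner_zero_right [simp]: "cinner \<phi> 0 = 0"
  by (simp add: cinner_def)

lemma cnj_cinner: "cnj (cinner \<phi> \<psi>) = cinner \<psi> \<phi>"
  by (simp add: cinner_def mult.commute)

lemma cinner_sum_left: "cinner (sum f A) \<psi> = (\<Sum>a\<in>A. cinner (f a) \<psi>)"
  by (induction A rule: infinite_finite_induct) (simp_all add: cinner_add_left)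

lemma cinner_sum_right: "cinner \<phi> (sum f A) = (\<Sum>a\<in>A. cinner \<phi> (f a))"
  by (induction A rule: infinite_finite_induct) (simp_all add: cinner_add_right)

lemma cinner_axis_left: "cinner (axis i 1) \<psi> = cnj (\<psi> $ i)"
  by (simp add: cinner_def axis_def if_distrib[of "\<lambda>x. x * _"] cong: if_cong)

lemma cinner_axis_right: "cinner \<phi> (axis i 1) = \<phi> $ i"
  by (metis cinner_axis_left cnj_cinner complex_cnj_cnj)

lemma is_adjoint_sym: "is_adjoint T S \<Longrightarrow> is_adjoint S T"
  unfolding is_adjoint_def by (metis cnj_cinner)

lemma is_adjoint_compose:
  assumes "is_adjoint T S" and "is_adjoint T' S'"
  shows "is_adjoint (\<lambda>\<psi>. T (T' \<psi>)) (\<lambda>\<psi>. S' (S \<psi>))"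
  using assms by (simp add: is_adjoint_def)

lemma is_adjoint_add:
  assumes "is_adjoint T S" and "is_adjoint T' S'"
  shows "is_adjoint (\<lambda>\<psi>. T \<psi> + T' \<psi>) (\<lambda>\<psi>. S \<psi> + S' \<psi>)"
  using assms by (simp add: is_adjoint_def cinner_add_left cinner_add_right)

text \<open>Moving a scalar across the inner product conjugates it; a real one comes back
  unchanged.\<close>

lemma is_adjoint_of_real_scale:
  assumes "is_adjoint T S"
  shows "is_adjoint (\<lambda>\<psi>. complex_of_real r *s T \<psi>) (\<lambda>\<psi>. complex_of_real r *s S \<psi>)"
  using assms by (simp add: is_adjoint_def cinner_scale_left cinner_scale_right)

lemma is_adjoint_sum:
  assumes "\<And>a. a \<in> A \<Longrightarrow> is_adjoint (T a) (S a)"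
  shows "is_adjoint (\<lambda>\<psi>. \<Sum>a\<in>A. T a \<psi>) (\<lambda>\<psi>. \<Sum>a\<in>A. S a \<psi>)"
  using assms by (simp add: is_adjoint_def cinner_sum_left cinner_sum_right)

text \<open>Each coordinate of \<open>T \<phi>\<close> is the inner product of \<open>\<phi>\<close>
  with a fixed vector, the image under \<open>S\<close> of a standard unit vector, and is therefore
  complex linear in \<open>\<phi>\<close>.\<close>

lemma bounded_operator_of_is_adjoint:
  assumes "is_adjoint T S"
  shows "bounded_operator T"
proof -
  have T: "T \<phi> $ i = cinner \<phi> (S (axis i 1))" for \<phi> i
    using assms by (metis is_adjoint_def cinner_axis_right)
  have add: "T (\<phi> + \<psi>) = T \<phi> + T \<psi>" for \<phi> \<psi>
    by (simp add: vec_eq_iff T cinner_add_left)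
  have scale: "T (c *s \<phi>) = c *s T \<phi>" for c \<phi>
    by (simp add: vec_eq_iff T cinner_scale_left)
  \<comment> \<open>\<open>linear\<close> speaks of real scaling, which is here a case of complex
    scaling.\<close>
  have real_scale: "r *\<^sub>R \<phi> = complex_of_real r *s \<phi>" for r and \<phi> :: "complex^'a"
    by (simp add: vec_eq_iff scaleR_conv_of_real[of r "x :: complex" for x])
  have "linear T"
    by (rule linearI) (simp_all only: add real_scale scale)
  then show ?thesis
    by (simp add: bounded_operator_def linear_conv_bounded_linear scale)
qed

lemma cinner_ket_left: "cinner (ket occ n) \<psi> = cnj (\<psi> $ inv occ n)"
  by (simp add: ket_def cinner_axis_left)

lemma cinner_ket_right: "cinner \<psi> (ket occ n) = \<psi> $ inv occ n"
  by (simp add: ket_def cinner_axis_right)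

text \<open>Occupation functions are extensional, so an update stays admissible only at a point of
  \<open>modes \<Lambda>\<close>.\<close>

lemma occupations_upd:
  assumes "n \<in> occupations \<Lambda>" and "p \<in> modes \<Lambda>" and "v \<in> {0, 1}"
  shows "n(p := v) \<in> occupations \<Lambda>"
  using assms
  by (auto simp: occupations_def PiE_iff extensional_def)

text \<open>A mode never lies to its own left, so the sign exponent does not see a change at
  \<open>p\<close>.\<close>

lemma sum_left_modes_upd:
  "(\<Sum>q\<in>left_modes \<Lambda> pos p. (n(p := v)) q) = (\<Sum>q\<in>left_modes \<Lambda> pos p. n q)"
  by (rule sum.cong) (auto simp: left_modes_def)

lemma is_adjoint_annihilation_creation:
  fixes occ :: "'n::finite \<Rightarrow> mode \<Rightarrow> nat"
  assumes occ: "bij_betw occ UNIV (occupations \<Lambda>)" and p: "p \<in> modes \<Lambda>"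
  shows "is_adjoint (annihilation \<Lambda> pos occ p) (creation \<Lambda> pos occ p)"
proof -
  \<comment> \<open>Both operators become signed index maps: \<open>s j\<close> is the sign, and
    \<open>flip v j\<close> is the index of the basis vector whose occupation of \<open>p\<close> is
    set to \<open>v\<close>.\<close>
  define s :: "'n \<Rightarrow> complex" where "s j = (-1) ^ (\<Sum>q\<in>left_modes \<Lambda> pos p. occ j q)" for j
  define flip where "flip v j = inv occ ((occ j)(p := v))" for v j
  have occ_in: "occ j \<in> occupations \<Lambda>" for j
    using occ by (auto simp: bij_betw_def)
  have inv_occ: "inv occ (occ j) = j" for j
    using occ by (simp add: bij_betw_def)
  have occ_flip: "occ (flip v j) = (occ j)(p := v)" if "v \<in> {0, 1}" for v j
  proof -
    \<comment> \<open>\<open>inv occ\<close> is a right inverse of \<open>occ\<close> only on the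
      range of \<open>occ\<close>.\<close>
    have "(occ j)(p := v) \<in> range occ"
      using occupations_upd[OF occ_in p that] occ by (simp add: bij_betw_def)
    then show ?thesis
      by (simp add: flip_def f_inv_into_f)
  qed
  have s_flip: "s (flip v j) = s j" if "v \<in> {0, 1}" for v j
    using that by (simp only: s_def occ_flip sum_left_modes_upd)
  \<comment> \<open>Restoring the original occupation undoes the flip, so \<open>flip 0\<close> and
    \<open>flip 1\<close> are inverse bijections between the indices with \<open>p\<close> occupied
    and those with \<open>p\<close> empty.\<close>
  have flip_flip: "flip w (flip v j) = j" if "v \<in> {0, 1}" "occ j p = w" for v w j
    using that occ_flip[of v j] inv_occ[of j] by (auto simp: flip_def[of w])
  have "cinner (annihilation \<Lambda> pos occ p \<phi>) \<psi> = cinner \<phi> (creation \<Lambda> pos occ p \<psi>)" for \<phi> \<psi>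
  proof -
    have "cinner (annihilation \<Lambda> pos occ p \<phi>) \<psi>
        = (\<Sum>j\<in>UNIV. if occ j p = 1 then \<phi> $ j * (s j * cnj (\<psi> $ flip 0 j)) else 0)"
      unfolding annihilation_def cinner_sum_left cinner_scale_left
      by (rule sum.cong) (auto simp: cinner_scale_left cinner_ket_left s_def flip_def)
    also have "\<dots> = (\<Sum>j | occ j p = 1. \<phi> $ j * (s j * cnj (\<psi> $ flip 0 j)))"
      by (simp add: sum.If_cases)
    \<comment> \<open>Substitute \<open>i = flip 0 j\<close>, hence \<open>j = flip 1 i\<close>; the
      sign is the same at both indices.\<close>
    also have "\<dots> = (\<Sum>i | occ i p = 0. cnj (\<psi> $ i) * (s i * \<phi> $ flip 1 i))"
      by (rule sum.reindex_bij_witness[where i = "flip 1" and j = "flip 0"])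
        (auto simp: flip_flip occ_flip s_flip)
    also have "\<dots> = (\<Sum>i\<in>UNIV. if occ i p = 0 then cnj (\<psi> $ i) * (s i * \<phi> $ flip 1 i) else 0)"
      by (simp add: sum.If_cases)
    also have "\<dots> = cinner \<phi> (creation \<Lambda> pos occ p \<psi>)"
      unfolding creation_def cinner_sum_right cinner_scale_right
      by (rule sum.cong) (auto simp: cinner_scale_right cinner_ket_right s_def flip_def)
    finally show ?thesis .
  qed
  then show ?thesis
    by (simp add: is_adjoint_def)
qed

text \<open>Negating the integer triple keeps the squares in the cutoff. This makes the modes at
  \<open>- k\<close> in the interaction genuine modes.\<close>

lemma uminus_in_Lam:
  assumes "k \<in> Lam L Kmax"
  shows "- k \<in> Lam L Kmax"
proof -
  obtain n1 n2 n3 :: int where k: "k = (2 * pi / L) *\<^sub>R vector [of_int n1, of_int n2, of_int n3]"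
    and le: "2 * pi / L * sqrt (of_int (n1\<^sup>2 + n2\<^sup>2 + n3\<^sup>2)) \<le> Kmax"
    using assms unfolding Lam_def by blast
  have "- k = (2 * pi / L) *\<^sub>R vector [of_int (- n1), of_int (- n2), of_int (- n3)]"
    by (simp add: k vec_eq_iff forall_3)
  moreover have "2 * pi / L * sqrt (of_int ((- n1)\<^sup>2 + (- n2)\<^sup>2 + (- n3)\<^sup>2)) \<le> Kmax"
    using le by simp
  ultimately show ?thesis
    unfolding Lam_def by blast
qed

lemma selfadjoint_BCS_Hamiltonian:
  fixes occ :: "'n::finite \<Rightarrow> mode \<Rightarrow> nat"
  assumes occ: "bij_betw occ UNIV (occupations \<Lambda>)"
    and neg: "\<And>k. k \<in> \<Lambda> \<Longrightarrow> - k \<in> \<Lambda>"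
    and U: "\<And>k k'. k \<in> \<Lambda> \<Longrightarrow> k' \<in> \<Lambda> \<Longrightarrow> U k' k = U k k'"
  shows "selfadjoint (BCS_Hamiltonian \<Lambda> pos occ \<xi> U)"
proof -
  define C where "C k \<sigma> = annihilation \<Lambda> pos occ (k, \<sigma>)" for k \<sigma>
  define Cs where "Cs k \<sigma> = creation \<Lambda> pos occ (k, \<sigma>)" for k \<sigma>
  \<comment> \<open>This operator removes the pair (\<open>k\<close> up, \<open>- k\<close> down)
    and creates the pair (\<open>k'\<close> up, \<open>- k'\<close> down).\<close>
  define pair where "pair k k' \<psi> = Cs k' Up (Cs (- k') Down (C (- k) Down (C k Up \<psi>)))" for k k' \<psi>
  define T where "T \<psi> = (\<Sum>k\<in>\<Lambda>. \<Sum>\<sigma>\<in>{Up, Down}. complex_of_real (\<xi> k) *s Cs k \<sigma> (C k \<sigma> \<psi>))" for \<psi>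
  define V where "V \<psi> = (\<Sum>k\<in>\<Lambda>. \<Sum>k'\<in>\<Lambda>. complex_of_real (U k k') *s pair k k' \<psi>)" for \<psi>
  have H: "BCS_Hamiltonian \<Lambda> pos occ \<xi> U = (\<lambda>\<psi>. T \<psi> + V \<psi>)"
    by (rule ext) (simp add: BCS_Hamiltonian_def Let_def T_def V_def pair_def C_def Cs_def)
  have C: "is_adjoint (C k \<sigma>) (Cs k \<sigma>)" if "k \<in> \<Lambda>" for k \<sigma>
    unfolding C_def Cs_def
    by (rule is_adjoint_annihilation_creation[OF occ]) (cases \<sigma>; use that in \<open>simp add: modes_def\<close>)
  have Cs: "is_adjoint (Cs k \<sigma>) (C k \<sigma>)" if "k \<in> \<Lambda>" for k \<sigma>
    using C[OF that] by (rule is_adjoint_sym)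
  \<comment> \<open>Reversing the four factors and exchanging \<open>C\<close> with
    \<open>Cs\<close> gives \<open>pair k' k\<close> in exactly its defining order, so no
    anticommutation relation enters.\<close>
  have pair: "is_adjoint (pair k k') (pair k' k)" if "k \<in> \<Lambda>" "k' \<in> \<Lambda>" for k k'
    using C[OF that(1), of Up] C[OF neg[OF that(1)], of Down]
      Cs[OF that(2), of Up] Cs[OF neg[OF that(2)], of Down]
    by (simp add: is_adjoint_def pair_def)
  have T: "is_adjoint T T"
    unfolding T_def
    by (intro is_adjoint_sum is_adjoint_of_real_scale) (rule is_adjoint_compose[OF Cs C])
  have "is_adjoint V (\<lambda>\<psi>. \<Sum>k\<in>\<Lambda>. \<Sum>k'\<in>\<Lambda>. complex_of_real (U k k') *s pair k' k \<psi>)"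
    unfolding V_def by (intro is_adjoint_sum is_adjoint_of_real_scale pair)
  also have "(\<lambda>\<psi>. \<Sum>k\<in>\<Lambda>. \<Sum>k'\<in>\<Lambda>. complex_of_real (U k k') *s pair k' k \<psi>) = V"
    \<comment> \<open>Swapping the sums exchanges the roles of \<open>k\<close> and
      \<open>k'\<close>; the symmetry of \<open>U\<close> then restores the coefficients.\<close>
    unfolding V_def by (rule ext, subst sum.swap) (simp add: U)
  finally show ?thesis
    unfolding selfadjoint_def H by (rule is_adjoint_add[OF T])
qed

theorem proposition2p5:
  fixes L Kmax m \<mu> hbar :: real
    and \<Lambda> :: "(real^3) set" and M :: nat
    and pos :: "real^3 \<Rightarrow> nat"
    and occ :: "'n::finite \<Rightarrow> mode \<Rightarrow> nat"
    and U :: "real^3 \<Rightarrow> real^3 \<Rightarrow> real"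
    and H :: "complex^'n \<Rightarrow> complex^'n"
  assumes "L > 0" and "Kmax > 0"
    and "\<Lambda> = Lam L Kmax" and "M = card \<Lambda>"
    and "bij_betw pos \<Lambda> {1..M}"
    and "CARD('n) = 2 ^ (2 * M)"
    and "bij_betw occ UNIV (occupations \<Lambda>)"
    and "m > 0" and "\<mu> > 0" and "hbar > 0"
    and "\<And>k k'. k \<in> \<Lambda> \<Longrightarrow> k' \<in> \<Lambda> \<Longrightarrow> U k k' \<le> 0"
    and "\<And>k k'. k \<in> \<Lambda> \<Longrightarrow> k' \<in> \<Lambda> \<Longrightarrow> U k' k = U k k'"
    and "\<And>k k'. k \<in> \<Lambda> \<Longrightarrow> k' \<in> \<Lambda> \<Longrightarrow> U (- k) (- k') = U k k'"
    and "\<And>k. k \<in> \<Lambda> \<Longrightarrow> U k k = 0"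
    and "H = BCS_Hamiltonian \<Lambda> pos occ (xi hbar m \<mu>) U"
  shows "bounded_operator H \<and> selfadjoint H"
proof -
  have "selfadjoint H"
    unfolding assms(15)
    by (rule selfadjoint_BCS_Hamiltonian) (use assms(3,7,12) uminus_in_Lam in auto)
  \<comment> \<open>Since \<open>H\<close> is its own adjoint, it has an adjoint, which already
    gives boundedness.\<close>
  then show ?thesis
    using bounded_operator_of_is_adjoint by (auto simp: selfadjoint_def)
qed

end
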